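(* Let $P=\{y_1,\ldots,y_d\}$ be a finite partially ordered set with $d\ge 1$ elements, and let $\mathcal{Q}_P\subset\mathbb{R}^d$ be the associated Fano polytope (defined in the context). Then $\mathcal{Q}_P$ is Gorenstein.
   Context: Let $P=\{y_1,\ldots,y_d\}$ be a finite partially ordered set with $d$ elements and $\hat P=P\cup\{\hat 0,\hat 1\}$, where $\hat 0\notin P$ is adjoined as the unique minimal element and $\hat 1\notin P$ as the unique maximal element of $\hat P$. Write $y_0=\hat 0$, $y_{d+1}=\hat 1$. An edge of $\hat P$ is an edge of the Hasse diagram of $\hat P$, i.e. a pair $\{y_i,y_j\}$ with $y_i<y_j$ in $\hat P$ and no $z\in P$ with $y_i<z<y_j$. Let $\mathbf{e}_i$ be the $i$th canonical unit coordinate vector of $\mathbb{R}^d$. For an edge $e=\{y_i,y_j\}$ of $\hat P$ with $y_i<y_j$, define $\rho(e)\in\mathbb{R}^d$ by $\rho(e)=\mathbf{e}_i$ if $j=d+1$; $\rho(e)=-\mathbf{e}_j$ if $i=0$; $\rho(e)=\mathbf{e}_i-\mathbf{e}_j$ if $1\le i,j\le d$. The polytope $\mathcal{Q}_P\subset\mathbb{R}^d$ is the convex hull of $\{\rho(e): e \text{ is an edge of } \hat P\}$. An integral polytope is a convex polytope all of whose vertices have integer coordinates. A Fano polytope in $\mathbb{R}^d$ is an integral convex polytope of dimension $d$ such that the origin is the unique integer point belonging to its interior. (It is a fact that $\mathcal{Q}_P$ is a Fano polytope.) The dual polytope of a Fano polytope $\mathcal{P}\subset\mathbb{R}^d$ is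 $\mathcal{P}^\vee=\{x\in\mathbb{R}^d:\langle x,y\rangle\le 1\text{ for all }y\in\mathcal{P}\}$, where $\langle\cdot,\cdot\rangle$ is the usual inner product. A Fano polytope is called Gorenstein if its dual polytope is integral. *)

theory Defs
  imports "HOL-Analysis.Analysis"
begin

text \<open>
  A poset is a carrier \<open>P\<close> with a reflexive order relation \<open>r\<close>.  The enumeration
  \<open>P = {y\<^sub>1, \<dots>, y\<^sub>d}\<close> is a bijection \<open>y\<close> from a finite index type \<open>'n\<close> onto \<open>P\<close>, so that
  \<open>d = CARD('n)\<close> and the ambient space is \<open>real ^ 'n\<close>.  The type \<open>'a hat\<close> adjoins a bottom and a
  top; it is used both for \<open>P\<close> and for the indices, \<open>Hat0\<close> and \<open>Hat1\<close> playing the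
  role of the indices \<open>0\<close> and \<open>d + 1\<close>, so that \<open>map_hat y\<close> is the enumeration of the extended poset.
\<close>

datatype 'a hat = Hat0 | Elt 'a | Hat1

fun hat_less :: "'a rel \<Rightarrow> 'a hat \<Rightarrow> 'a hat \<Rightarrow> bool" where
  "hat_less r Hat0 b = (b \<noteq> Hat0)"
| "hat_less r (Elt p) Hat0 = False"
| "hat_less r (Elt p) (Elt q) = ((p, q) \<in> r \<and> p \<noteq> q)"
| "hat_less r (Elt p) Hat1 = True"
| "hat_less r Hat1 b = False"

definition hat_carrier :: "'a set \<Rightarrow> 'a hat set" where
  "hat_carrier P = {Hat0, Hat1} \<union> Elt ` P"

text \<open>An edge of the Hasse diagram, given with its lower end first.\<close>

definition hat_edge :: "'a set \<Rightarrow> 'a rel \<Rightarrow> 'a hat \<Rightarrow> 'a hat \<Rightarrow> bool" where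
  "hat_edge P r a b \<longleftrightarrow>
     a \<in> hat_carrier P \<and> b \<in> hat_carrier P \<and> hat_less r a b \<and>
     \<not> (\<exists>z\<in>P. hat_less r a (Elt z) \<and> hat_less r (Elt z) b)"

text \<open>
  The last equation is a dummy value: \<open>Hat0\<close>, \<open>Hat1\<close> is not an edge when \<open>P\<close> is nonempty,
  and no other pair it covers is increasing.
\<close>

fun edge_vec :: "'n::finite hat \<Rightarrow> 'n hat \<Rightarrow> real ^ 'n" where
  "edge_vec (Elt i) Hat1 = axis i 1"
| "edge_vec Hat0 (Elt j) = - axis j 1"
| "edge_vec (Elt i) (Elt j) = axis i 1 - axis j 1"
| "edge_vec _ _ = 0"

definition poset_polytope :: "'a set \<Rightarrow> 'a rel \<Rightarrow> ('n::finite \<Rightarrow> 'a) \<Rightarrow> (real ^ 'n) set" where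
  "poset_polytope P r y =
     convex hull {edge_vec i j | i j. hat_edge P r (map_hat y i) (map_hat y j)}"

definition integer_point :: "real ^ 'n \<Rightarrow> bool" where
  "integer_point x \<longleftrightarrow> (\<forall>i. x $ i \<in> \<int>)"

definition integral_polytope :: "(real ^ 'n::finite) set \<Rightarrow> bool" where
  "integral_polytope S \<longleftrightarrow> polytope S \<and> (\<forall>v. v extreme_point_of S \<longrightarrow> integer_point v)"

definition fano_polytope :: "(real ^ 'n::finite) set \<Rightarrow> bool" where
  "fano_polytope S \<longleftrightarrow>
     integral_polytope S \<and> aff_dim S = int CARD('n) \<and>
     {x \<in> interior S. integer_point x} = {0}"

definition dual_polytope :: "(real ^ 'n::finite) set \<Rightarrow> (real ^ 'n) set" where
  "dual_polytope S = {x. \<forall>y\<in>S. x \<bullet> y \<le> 1}"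

definition gorenstein_polytope :: "(real ^ 'n::finite) set \<Rightarrow> bool" where
  "gorenstein_polytope S \<longleftrightarrow> fano_polytope S \<and> integral_polytope (dual_polytope S)"

end

theory Submission
  imports Defs
begin

text \<open>
  Read a vector \<open>x\<close> as a function on the extended poset that vanishes at both adjoined
  elements. The inner product of \<open>x\<close> with the vector of an edge is then the drop of that
  function along the edge, and the theorem becomes a statement about such functions.

  The polytope is Fano. Suppose the origin were not an interior point. By separation a nonzero
  function would be monotone along all edges; since saturated chains join the bottom through any
  element to the top (\<open>hat_less_imp_trancl_edge\<close>), and the function is 0 at both ends, it
  would vanish (\<open>edgewise_monotone_height_zero\<close>). So the origin is interior, which also gives
  full dimension. All edge vectors have entries in \<open>{-1, 0, 1}\<close>, hence the polytope lies in
  the cube \<open>[-1, 1]\<^sup>d\<close>, and the interior of this cube has no other integer point.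

  The dual is integral. It is the set of functions that drop by at most 1 along each
  edge, a polyhedron, bounded because the origin is interior to the original polytope. If one of
  its points \<open>x\<close> has a nonintegral entry, take all elements at which \<open>x\<close> has the same
  fractional part as at this entry, and shift \<open>x\<close> by a small common amount on them. A drop along an
  edge changes only if exactly one end is shifted; then the drop is not an integer, hence is
  strictly below 1. So small shifts in both directions stay in the dual, and \<open>x\<close> is not
  extreme (\<open>extreme_point_dual_integer\<close>).
\<close>

section \<open>Edge vectors as differences of heights\<close>

fun height :: "real ^ 'n \<Rightarrow> 'n hat \<Rightarrow> real" where
  "height x (Elt i) = x $ i"
| "height x _ = 0"

text \<open>
  For the pair \<open>Hat1\<close>, \<open>Elt j\<close> the dummy value \<open>0\<close> would violate the equation; such a
  pair is not an edge.
\<close>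

lemma inner_edge_vec:
  assumes "hat_edge P r (map_hat y a) (map_hat y b)"
  shows "x \<bullet> edge_vec a b = height x a - height x b"
  using assms
  by (cases a; cases b) (auto simp: hat_edge_def inner_axis inner_diff_right)

lemma finite_UNIV_hat: "finite (UNIV :: 'n::finite hat set)"
proof -
  have "(UNIV :: 'n hat set) = {Hat0, Hat1} \<union> range Elt"
    by (auto intro: hat.exhaust)
  then show ?thesis
    by (metis finite.emptyI finite.insertI finite_UnI finite_class.finite_UNIV finite_imageI)
qed

lemma edge_vec_component: "edge_vec a b $ k \<in> {-1, 0, 1}"
  by (cases a; cases b) (auto simp: axis_def)

section \<open>Saturated chains\<close>

lemma hat_less_trans:
  assumes "trans r" "antisym r" "hat_less r a b" "hat_less r b c"
  shows "hat_less r a c"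
  using assms by (cases a; cases b; cases c) (auto dest: transD antisymD)

lemma hat_less_irrefl: "\<not> hat_less r a a"
  by (cases a) auto

text \<open>
  Any element strictly between \<open>a\<close> and \<open>b\<close> splits the interval into two smaller ones, so
  in a finite poset repeated refinement ends with a chain of edges.
\<close>

lemma hat_less_imp_trancl_edge:
  assumes fin: "finite P" and r: "trans r" "antisym r"
    and ab: "a \<in> hat_carrier P" "b \<in> hat_carrier P" "hat_less r a b"
  shows "(a, b) \<in> {(a, b). hat_edge P r a b}\<^sup>+"
  using ab
proof (induction "card {z \<in> P. hat_less r a (Elt z) \<and> hat_less r (Elt z) b}"
    arbitrary: a b rule: less_induct)
  case less
  let ?I = "\<lambda>a b. {z \<in> P. hat_less r a (Elt z) \<and> hat_less r (Elt z) b}"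
  show ?case
  proof (cases "hat_edge P r a b")
    case True
    then show ?thesis by auto
  next
    case False
    then obtain z where z: "z \<in> P" "hat_less r a (Elt z)" "hat_less r (Elt z) b"
      using less.prems by (auto simp: hat_edge_def)
    have "?I a (Elt z) \<subset> ?I a b" "?I (Elt z) b \<subset> ?I a b"
      using z hat_less_trans[OF r] hat_less_irrefl by blast+
    then have "card (?I a (Elt z)) < card (?I a b)" "card (?I (Elt z) b) < card (?I a b)"
      using fin by (auto intro: psubset_card_mono)
    moreover have "Elt z \<in> hat_carrier P"
      using z by (simp add: hat_carrier_def)
    ultimately show ?thesis
      using less.hyps[of a "Elt z"] less.hyps[of "Elt z" b] less.prems z
      by (meson trancl_trans)
  qed
qed

text \<open>
  Monotonicity along edges propagates along chains. Each element lies on a chain from the bottom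
  to the top, where the height is 0, so its height is squeezed between 0 and 0.
\<close>

lemma edgewise_monotone_height_zero:
  fixes y :: "'n::finite \<Rightarrow> 'a"
  assumes po: "partial_order_on P r" and y: "bij_betw y UNIV P"
    and mono: "\<And>a b. hat_edge P r (map_hat y a) (map_hat y b) \<Longrightarrow> height x b \<le> height x a"
  shows "x = 0"
proof -
  define g where "g = inv (map_hat y)"
  have inj: "inj y" and ran: "range y = P"
    using y by (auto simp: bij_betw_def)
  have g: "g (map_hat y a) = a" for a
    unfolding g_def using hat.inj_map[OF inj] by (rule inv_f_f)
  have surj: "p \<in> hat_carrier P \<Longrightarrow> \<exists>a. p = map_hat y a" for p
    using ran unfolding hat_carrier_def by (metis (no_types, lifting) Un_iff empty_iff hat.map(1,2,3) imageE insert_iff)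
  \<comment> \<open>Heights live on indices, chains on poset elements; \<open>g\<close> translates back.\<close>
  have "height x (g q) \<le> height x (g p)" if "(p, q) \<in> {(a, b). hat_edge P r a b}\<^sup>+" for p q
    using that
  proof induction
    case (base q)
    then show ?case
      using mono surj g by (metis case_prodD hat_edge_def mem_Collect_eq)
  next
    case (step q s)
    then have "hat_edge P r q s" by simp
    then have "height x (g s) \<le> height x (g q)"
      using mono surj g by (metis hat_edge_def)
    then show ?case
      using step.IH by linarith
  qed
  moreover have "finite P" "trans r" "antisym r"
    using po ran unfolding partial_order_on_def preorder_on_def by auto
  ultimately have anti: "height x (g q) \<le> height x (g p)"
    if "p \<in> hat_carrier P" "q \<in> hat_carrier P" "hat_less r p q" for p q
    using that hat_less_imp_trancl_edge by metis
  have "x $ i = 0" for i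
  proof (rule antisym)
    have "Elt (y i) \<in> hat_carrier P" "Hat0 \<in> hat_carrier P" "Hat1 \<in> hat_carrier P"
      using ran by (auto simp: hat_carrier_def)
    then show "x $ i \<le> 0" "0 \<le> x $ i"
      using anti[of Hat0 "Elt (y i)"] anti[of "Elt (y i)" Hat1] g[of Hat0] g[of Hat1] g[of "Elt i"]
      by auto
  qed
  then show ?thesis
    by (simp add: vec_eq_iff)
qed

section \<open>The origin is an interior point\<close>

text \<open>
  Separating the origin from the set alone would not suffice, as the origin may lie on the
  boundary. A convex set with nonempty interior is contained in the closure of its interior, so
  a functional separating the interior works; with empty interior the set lies in a hyperplane,
  whose normal, up to sign, works.
\<close>

lemma supporting_functional_at_zero:
  fixes S :: "'a::euclidean_space set"
  assumes "convex S" "0 \<notin> interior S"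
  obtains c where "c \<noteq> 0" "\<And>x. x \<in> S \<Longrightarrow> 0 \<le> c \<bullet> x"
proof (cases "interior S = {}")
  case True
  then obtain c b where c: "c \<noteq> 0" "S \<subseteq> {x. c \<bullet> x = b}"
    using empty_interior_subset_hyperplane[OF assms(1)] by metis
  show ?thesis
  proof (cases "b \<ge> 0")
    case True
    then show ?thesis using that[of c] c by auto
  next
    case False
    then show ?thesis using that[of "- c"] c by (force simp: subset_iff)
  qed
next
  case False
  obtain c where c: "c \<noteq> 0" "\<forall>x\<in>interior S. 0 \<le> c \<bullet> x"
    using separating_hyperplane_set_0[OF convex_interior[OF assms(1)] assms(2)] by blast
  have "closure (interior S) \<subseteq> {x. 0 \<le> c \<bullet> x}"
    using c closed_halfspace_ge[of 0 c] by (intro closure_minimal) auto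
  then have "S \<subseteq> {x. 0 \<le> c \<bullet> x}"
    using convex_closure_interior[OF assms(1) False] closure_subset by blast
  then show ?thesis
    using that[of c] c(1) by auto
qed

lemma zero_in_interior_poset_polytope:
  fixes y :: "'n::finite \<Rightarrow> 'a"
  assumes "partial_order_on P r" "bij_betw y UNIV P"
  shows "0 \<in> interior (poset_polytope P r y)"
proof (rule ccontr)
  assume "0 \<notin> interior (poset_polytope P r y)"
  then obtain c where c: "c \<noteq> 0" "\<And>x. x \<in> poset_polytope P r y \<Longrightarrow> 0 \<le> c \<bullet> x"
    using supporting_functional_at_zero[of "poset_polytope P r y"]
    by (auto simp: poset_polytope_def)
  have "height c b \<le> height c a" if e: "hat_edge P r (map_hat y a) (map_hat y b)" for a b
  proof -
    have "edge_vec a b \<in> poset_polytope P r y"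
      unfolding poset_polytope_def using e by (blast intro: hull_inc)
    then show ?thesis
      using c(2) inner_edge_vec[OF e] by fastforce
  qed
  then have "c = 0"
    using edgewise_monotone_height_zero[OF assms] by blast
  with c(1) show False by blast
qed

section \<open>The Fano property\<close>

lemma finite_edge_vecs:
  fixes y :: "'n::finite \<Rightarrow> 'a"
  shows "finite {edge_vec i j | i j. hat_edge P r (map_hat y i) (map_hat y j)}"
proof -
  have "{edge_vec i j | i j. hat_edge P r (map_hat y i) (map_hat y j)}
      \<subseteq> (\<lambda>(i, j). edge_vec i j) ` (UNIV \<times> UNIV)"
    by auto
  then show ?thesis
    using finite_UNIV_hat by (meson finite_SigmaI finite_imageI finite_subset)
qed

lemma poset_polytope_subset_cube: "poset_polytope P r y \<subseteq> cbox (- 1) 1"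
  unfolding poset_polytope_def
proof (rule hull_minimal)
  show "{edge_vec i j | i j. hat_edge P r (map_hat y i) (map_hat y j)} \<subseteq> cbox (- 1) 1"
  proof clarify
    fix a b :: "'a hat"
    have "- 1 \<le> edge_vec a b $ k \<and> edge_vec a b $ k \<le> 1" for k
      using edge_vec_component[of a b k] by auto
    then show "edge_vec a b \<in> cbox (- 1) 1"
      by (simp add: mem_box_cart)
  qed
qed (rule convex_box)

lemma fano_poset_polytope:
  fixes y :: "'n::finite \<Rightarrow> 'a"
  assumes "partial_order_on P r" "bij_betw y UNIV P"
  shows "fano_polytope (poset_polytope P r y)"
proof -
  let ?Q = "poset_polytope P r y"
  note zero = zero_in_interior_poset_polytope[OF assms]
  have "polytope ?Q"
    unfolding poset_polytope_def by (rule polytope_convex_hull[OF finite_edge_vecs])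
  moreover have "integer_point v" if v: "v extreme_point_of ?Q" for v
  proof -
    obtain a b where "v = edge_vec a b"
      using extreme_point_of_convex_hull v[unfolded poset_polytope_def] by blast
    then show ?thesis
      using edge_vec_component[of a b] unfolding integer_point_def
      by (metis Ints_0 Ints_1 Ints_minus empty_iff insert_iff)
  qed
  moreover have "aff_dim ?Q = int CARD('n)"
    using aff_dim_nonempty_interior[of ?Q] zero by auto
  moreover have "{x \<in> interior ?Q. integer_point x} = {0}"
  proof -
    have "x = 0" if "x \<in> interior ?Q" "integer_point x" for x
    proof -
      have "x \<in> box (- 1) 1"
        using interior_mono[OF poset_polytope_subset_cube, of P r y] that(1) by (auto simp: interior_cbox)
      then have "\<bar>x $ k\<bar> < 1" for k
        by (auto simp: mem_box_cart abs_less_iff minus_less_iff)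
      then show ?thesis
        using that(2) unfolding integer_point_def vec_eq_iff by (metis Ints_nonzero_abs_less1 zero_index)
    qed
    then show ?thesis
      using zero by (auto simp: integer_point_def)
  qed
  ultimately show ?thesis
    by (simp add: fano_polytope_def integral_polytope_def)
qed

section \<open>Integrality of the dual\<close>

lemma dual_convex_hull:
  "dual_polytope (convex hull V) = (\<Inter>v\<in>V. {x. v \<bullet> x \<le> 1})"
proof
  show "dual_polytope (convex hull V) \<subseteq> (\<Inter>v\<in>V. {x. v \<bullet> x \<le> 1})"
    by (auto simp: dual_polytope_def inner_commute hull_inc)
  show "(\<Inter>v\<in>V. {x. v \<bullet> x \<le> 1}) \<subseteq> dual_polytope (convex hull V)"
  proof
    fix x assume "x \<in> (\<Inter>v\<in>V. {x. v \<bullet> x \<le> 1})"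
    then have "convex hull V \<subseteq> {v. x \<bullet> v \<le> 1}"
      by (intro hull_minimal convex_halfspace_le) (auto simp: inner_commute)
    then show "x \<in> dual_polytope (convex hull V)"
      by (auto simp: dual_polytope_def)
  qed
qed

text \<open>
  If \<open>S\<close> contains the ball of radius \<open>e\<close>, testing \<open>x\<close> against the vector of length \<open>e\<close>
  in its own direction gives \<open>e * norm x \<le> 1\<close>.
\<close>

lemma bounded_dual_polytope:
  assumes "0 \<in> interior S"
  shows "bounded (dual_polytope S)"
proof -
  obtain e where e: "e > 0" "cball 0 e \<subseteq> S"
    using assms by (auto simp: mem_interior_cball)
  have "norm x \<le> 1 / e" if x: "x \<in> dual_polytope S" for x
  proof (cases "x = 0")
    case False
    have "(e / norm x) *\<^sub>R x \<in> S"
      using e False by (intro subsetD[OF e(2)]) simp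
    then have "x \<bullet> ((e / norm x) *\<^sub>R x) \<le> 1"
      using x unfolding dual_polytope_def by blast
    then have "e * norm x \<le> 1"
      using False by (simp add: dot_square_norm power2_eq_square)
    then show ?thesis
      using e(1) by (simp add: field_simps)
  qed (use e in simp)
  then show ?thesis
    by (auto simp: bounded_iff)
qed

text \<open>
  The direction \<open>u\<close> is the indicator of the coordinates congruent modulo \<open>\<int>\<close> to a
  nonintegral one; every constraint that is tight at \<open>x\<close> is constant along \<open>u\<close>.
\<close>

lemma extreme_point_dual_integer:
  fixes y :: "'n::finite \<Rightarrow> 'a"
  assumes ext: "x extreme_point_of dual_polytope (poset_polytope P r y)"
  shows "integer_point x"
proof (rule ccontr)
  let ?V = "{edge_vec i j | i j. hat_edge P r (map_hat y i) (map_hat y j)}"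
  have D: "dual_polytope (poset_polytope P r y) = (\<Inter>v\<in>?V. {z. v \<bullet> z \<le> 1})"
    unfolding poset_polytope_def by (rule dual_convex_hull)
  assume "\<not> integer_point x"
  then obtain i where i: "x $ i \<notin> \<int>"
    by (auto simp: integer_point_def)
  define u :: "real ^ 'n" where "u = (\<chi> j. if x $ j - x $ i \<in> \<int> then 1 else 0)"
  have "u $ i = 1"
    by (simp add: u_def)
  then have "u \<noteq> 0"
    by auto
  \<comment> \<open>At the adjoined ends this holds because the height 0 differs from the
    nonintegral \<open>x $ i\<close> by a non-integer.\<close>
  have hu: "height u a = (if height x a - x $ i \<in> \<int> then 1 else 0)" for a
    using i by (cases a) (auto simp: u_def)
  have "\<forall>\<^sub>F s in at_right (0::real). v \<bullet> (x + s *\<^sub>R u) \<le> 1 \<and> v \<bullet> (x - s *\<^sub>R u) \<le> 1"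
    if v: "v \<in> ?V" for v
  proof -
    obtain a b where ab: "v = edge_vec a b" "hat_edge P r (map_hat y a) (map_hat y b)"
      using v by blast
    have vx: "v \<bullet> x = height x a - height x b" and vu: "v \<bullet> u = height u a - height u b"
      using inner_edge_vec[OF ab(2)] ab(1) by (simp_all add: inner_commute)
    have le: "v \<bullet> x \<le> 1"
      using ext v unfolding extreme_point_of_def D by blast
    show ?thesis
    proof (cases "v \<bullet> u = 0")
      case True
      then show ?thesis
        using le by (simp add: inner_add_right inner_diff_right)
    next
      case False
      have "v \<bullet> x \<noteq> 1"
      proof
        assume "v \<bullet> x = 1"
        then have "height x a - x $ i = (height x b - x $ i) + 1"
          using vx by simp
        then have "height x a - x $ i \<in> \<int> \<longleftrightarrow> height x b - x $ i \<in> \<int>"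
          by (metis Ints_1 Ints_add Ints_diff add_diff_cancel_right')
        then show False
          using False vu by (simp add: hu)
      qed
      with le have "0 < 1 - v \<bullet> x"
        by simp
      then have "\<forall>\<^sub>F s in at_right (0::real). s \<in> {0<..<1 - v \<bullet> x}"
        by (rule eventually_at_right_real)
      then show ?thesis
      proof eventually_elim
        case (elim s)
        have "v \<bullet> u = 1 \<or> v \<bullet> u = - 1"
          using False vu by (auto simp: hu split: if_splits)
        then show ?case
          using elim by (auto simp: inner_add_right inner_diff_right)
      qed
    qed
  qed
  then have "\<forall>\<^sub>F s in at_right (0::real). \<forall>v\<in>?V. v \<bullet> (x + s *\<^sub>R u) \<le> 1 \<and> v \<bullet> (x - s *\<^sub>R u) \<le> 1"
    using finite_edge_vecs by (intro eventually_ball_finite) auto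
  then have "\<forall>\<^sub>F s in at_right (0::real). s > 0 \<and>
      (\<forall>v\<in>?V. v \<bullet> (x + s *\<^sub>R u) \<le> 1 \<and> v \<bullet> (x - s *\<^sub>R u) \<le> 1)"
    by (rule eventually_conj[OF eventually_at_right_less])
  from eventually_happens'[OF _ this] obtain s :: real where s: "s > 0"
    "\<forall>v\<in>?V. v \<bullet> (x + s *\<^sub>R u) \<le> 1 \<and> v \<bullet> (x - s *\<^sub>R u) \<le> 1"
    by auto
  have "x + s *\<^sub>R u \<in> dual_polytope (poset_polytope P r y)"
       "x - s *\<^sub>R u \<in> dual_polytope (poset_polytope P r y)"
    using s(2) unfolding D by blast+
  moreover have "x \<in> open_segment (x - s *\<^sub>R u) (x + s *\<^sub>R u)"
  proof -
    have "midpoint (x - s *\<^sub>R u) (x + s *\<^sub>R u) = x"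
      by (simp add: midpoint_def scaleR_2[symmetric])
    moreover have "x - s *\<^sub>R u \<noteq> x + s *\<^sub>R u"
    proof
      assume "x - s *\<^sub>R u = x + s *\<^sub>R u"
      then have "(2 * s) *\<^sub>R u = 0"
        by (simp add: algebra_simps flip: scaleR_2)
      then show False
        using s(1) \<open>u \<noteq> 0\<close> by simp
    qed
    ultimately show ?thesis
      by (metis midpoint_in_open_segment)
  qed
  ultimately show False
    using ext unfolding extreme_point_of_def by blast
qed

lemma integral_dual_poset_polytope:
  fixes y :: "'n::finite \<Rightarrow> 'a"
  assumes "partial_order_on P r" "bij_betw y UNIV P"
  shows "integral_polytope (dual_polytope (poset_polytope P r y))"
proof -
  have "polyhedron (dual_polytope (poset_polytope P r y))"
    unfolding poset_polytope_def dual_convex_hull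
    using finite_edge_vecs by (auto intro!: polyhedron_Inter polyhedron_halfspace_le)
  then show ?thesis
    unfolding integral_polytope_def polytope_eq_bounded_polyhedron
    using bounded_dual_polytope zero_in_interior_poset_polytope[OF assms]
      extreme_point_dual_integer by blast
qed

theorem lemma1p5:
  fixes P :: "'a set" and r :: "'a rel" and y :: "'n::finite \<Rightarrow> 'a"
  assumes "partial_order_on P r"
    and "bij_betw y UNIV P"
  shows "gorenstein_polytope (poset_polytope P r y)"
  using fano_poset_polytope[OF assms] integral_dual_poset_polytope[OF assms]
  by (simp add: gorenstein_polytope_def)

end
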